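(* Let $T$ be a tree of order $n \geq 4$ with maximum degree $\Delta(T) \geq 3$. Then $$hc(T) \geq (n-1)(n-1-\varepsilon(T)) + \varepsilon'(T) - 2\mathcal{L}(T).$$
   Context: For a connected graph $G$ of order $n$ (finite, simple), $D(u,v)$ denotes the detour distance between vertices $u,v$, i.e. the length of a longest $u,v$-path in $G$ (for a tree this is the ordinary distance). A hamiltonian coloring of $G$ is a map $c: V(G)\to\{0,1,2,\dots\}$ such that $D(u,v)+|c(u)-c(v)|\geq n-1$ for every two distinct vertices $u,v$. The value $hc(c)$ is the maximum color assigned by $c$, and the hamiltonian chromatic number $hc(G)$ is the minimum of $hc(c)$ over all hamiltonian colorings $c$ of $G$ (note that the color $0$ is allowed). For a tree $T$, the center $C(T)$ is the set of vertices of minimum eccentricity; it consists of either one vertex $w$ or two adjacent vertices $w,w'$ (the central vertex/vertices). For $u\in V(T)$ put $\mathcal{L}(u)=\min\{D(u,w): w\in C(T)\}$ (the detour level), and $\mathcal{L}(T)=\sum_{u\in V(T)}\mathcal{L}(u)$ (the total detour level). Put $\varepsilon(T)=0$ if $|C(T)|=1$, $\varepsilon(T)=1$ if $|C(T)|=2$, and $\varepsilon'(T)=1-\varepsilon(T)$. *)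

theory Defs
  imports "Graph_Theory.Graph_Theory"
begin

text \<open>
  A finite simple graph is a \<^locale>\<open>pair_graph\<close>, in which an undirected edge is a pair of opposite
  arcs. The predicate \<^const>\<open>tree\<close> is therefore unsuitable here: it forbids every directed cycle,
  including the cycle of length 2 that each undirected edge gives rise to. Cycles of the
  undirected graph are the directed ones of length at least 3.
\<close>

definition undirected_tree :: "'a pair_pre_digraph \<Rightarrow> bool" where
  "undirected_tree G \<longleftrightarrow> pair_graph G \<and> Digraph_Component.connected G \<and>
     \<not> (\<exists>p. pre_digraph.cycle G p \<and> 3 \<le> length p)"

definition order :: "'a pair_pre_digraph \<Rightarrow> nat" where
  "order G = card (pverts G)"

definition max_degree :: "'a pair_pre_digraph \<Rightarrow> nat" where
  "max_degree G = Max (out_degree G ` pverts G)"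

definition distance :: "'a pair_pre_digraph \<Rightarrow> 'a \<Rightarrow> 'a \<Rightarrow> nat" where
  "distance G u v = (INF p\<in>{p. pre_digraph.awalk G u p v}. length p)"

definition detour_distance :: "'a pair_pre_digraph \<Rightarrow> 'a \<Rightarrow> 'a \<Rightarrow> nat" where
  "detour_distance G u v = Max (length ` {p. pre_digraph.apath G u p v})"

definition hamiltonian_coloring :: "'a pair_pre_digraph \<Rightarrow> ('a \<Rightarrow> nat) \<Rightarrow> bool" where
  "hamiltonian_coloring G c \<longleftrightarrow>
     (\<forall>u\<in>pverts G. \<forall>v\<in>pverts G. u \<noteq> v \<longrightarrow>
        int (detour_distance G u v) + \<bar>int (c u) - int (c v)\<bar> \<ge> int (order G) - 1)"

definition coloring_value :: "'a pair_pre_digraph \<Rightarrow> ('a \<Rightarrow> nat) \<Rightarrow> nat" where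
  "coloring_value G c = Max (c ` pverts G)"

definition hamiltonian_chromatic_number :: "'a pair_pre_digraph \<Rightarrow> nat" where
  "hamiltonian_chromatic_number G = (INF c\<in>{c. hamiltonian_coloring G c}. coloring_value G c)"

definition eccentricity :: "'a pair_pre_digraph \<Rightarrow> 'a \<Rightarrow> nat" where
  "eccentricity G u = Max (distance G u ` pverts G)"

definition center :: "'a pair_pre_digraph \<Rightarrow> 'a set" where
  "center G = {u \<in> pverts G. \<forall>v\<in>pverts G. eccentricity G u \<le> eccentricity G v}"

definition detour_level :: "'a pair_pre_digraph \<Rightarrow> 'a \<Rightarrow> nat" where
  "detour_level G u = Min (detour_distance G u ` center G)"

definition total_detour_level :: "'a pair_pre_digraph \<Rightarrow> nat" where
  "total_detour_level G = (\<Sum>u\<in>pverts G. detour_level G u)"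

text \<open>The center of a tree has one or two vertices, so the last case below never arises for trees.\<close>

definition eps :: "'a pair_pre_digraph \<Rightarrow> int" where
  "eps G = (if card (center G) = 1 then 0 else if card (center G) = 2 then 1 else undefined)"

definition eps' :: "'a pair_pre_digraph \<Rightarrow> int" where
  "eps' G = 1 - eps G"

end

theory Submission
  imports Defs
begin

text \<open>
  List the vertices as \<open>u\<^sub>0, \<dots>, u\<^sub>m\<close> with \<open>m = n - 1\<close>, by increasing colour. Consecutive colours
  differ by at least \<open>m - D(u\<^sub>i, u\<^sub>i\<^sub>+\<^sub>1)\<close>, and the route through the center gives
  \<open>D(u, v) \<le> L(u) + L(v) + \<epsilon>\<close>. In the telescoping sum every level occurs twice, except those of
  \<open>u\<^sub>0\<close> and \<open>u\<^sub>m\<close>, which occur once; together these two levels are at least \<open>\<epsilon>'\<close>, because two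
  distinct vertices cannot both be the unique central vertex.
\<close>

section \<open>Walks and unique paths in a tree\<close>

lemma distance_le_length_awalk:
  "pre_digraph.awalk (with_proj G) u p v \<Longrightarrow> distance G u v \<le> length p"
  unfolding distance_def by (rule cINF_lower) auto

locale tree_graph = pair_graph G for G :: "'a pair_pre_digraph" +
  assumes is_tree: "undirected_tree G"
begin

lemma no_long_cycle: "cycle p \<Longrightarrow> length p < 3"
  using is_tree unfolding undirected_tree_def by (meson not_le)

lemma verts_nonempty: "pverts G \<noteq> {}"
  using is_tree unfolding undirected_tree_def connected_def strongly_connected_def by auto

lemma apath_exists:
  assumes "u \<in> pverts G" "v \<in> pverts G"
  obtains p where "apath u p v"
proof -
  \<comment> \<open>Connectedness concerns the symmetric closure only; arcs come in opposite pairs,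
    which turns it into directed reachability.\<close>
  have "strongly_connected G"
    using is_tree symmetric_connected_imp_strongly_connected[OF pair_sym_arcs]
    unfolding undirected_tree_def by blast
  then have "u \<rightarrow>\<^sup>*\<^bsub>G\<^esub> v" using assms unfolding strongly_connected_def by auto
  then show thesis using that unfolding reachable_apath by blast
qed

text \<open>Shortening a walk to a path only drops arcs, so no vertex is gained. In the cycle
  argument below this keeps the branching vertex off the shortened path.\<close>

lemma awalk_verts_awalk_to_apath_subset:
  assumes "awalk u p v"
  shows "set (awalk_verts u (awalk_to_apath p)) \<subseteq> set (awalk_verts u p)"
  using awalk_to_apath_subset[OF assms] set_awalk_verts[OF assms]
    set_awalk_verts[OF awalkI_apath[OF apath_awalk_to_apath[OF assms]]]
  by auto

lemma apath_same_ends: "apath u p u \<Longrightarrow> p = []"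
  using apath_nonempty_ends by blast

text \<open>Where two paths with the same ends first diverge, the remainders of both, joined at their
  common end, connect two neighbours of the branching vertex without meeting it: a cycle.\<close>

lemma apath_unique: "apath u p v \<Longrightarrow> apath u q v \<Longrightarrow> p = q"
proof (induction p arbitrary: u q)
  case Nil
  then show ?case using apath_same_ends by (auto simp: apath_Nil_iff)
next
  case (Cons e p)
  obtain f q' where q: "q = f # q'"
    using Cons.prems apath_same_ends by (cases q) (auto simp: apath_Nil_iff)
  have e: "e \<in> parcs G" "fst e = u" "apath (snd e) p v" "u \<notin> set (awalk_verts (snd e) p)"
    using Cons.prems(1) by (auto simp: apath_Cons_iff)
  have f: "f \<in> parcs G" "fst f = u" "apath (snd f) q' v" "u \<notin> set (awalk_verts (snd f) q')"
    using Cons.prems(2) unfolding q by (auto simp: apath_Cons_iff)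
  show ?case
  proof (cases "snd e = snd f")
    case True
    then have "e = f" using e f by (simp add: prod_eq_iff)
    then show ?thesis using Cons.IH[OF e(3)] f(3) True q by simp
  next
    case False
    define r where "r = awalk_to_apath (p @ rev_path q')"
    have walks: "awalk (snd e) p v" "awalk v (rev_path q') (snd f)"
      using e f by (auto intro: awalkI_apath)
    then have w: "awalk (snd e) (p @ rev_path q') (snd f)"
      by (rule awalk_appendI)
    have r: "apath (snd e) r (snd f)"
      unfolding r_def by (rule apath_awalk_to_apath[OF w])
    have "set (awalk_verts (snd e) (p @ rev_path q'))
        = set (awalk_verts (snd e) p) \<union> set (awalk_verts v (rev_path q'))"
      using set_awalk_verts_append[OF walks] by simp
    also have "set (awalk_verts v (rev_path q')) = set (awalk_verts (snd f) q')"
      using awalk_verts_rev_path[OF awalkI_apath[OF f(3)]] by simp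
    finally have ur: "u \<notin> set (awalk_verts (snd e) r)"
      using awalk_verts_awalk_to_apath_subset[OF w] e(4) f(4) unfolding r_def by auto
    have back_arc: "(snd f, u) \<in> parcs G"
      using arcs_symmetric f by (metis prod.collapse)
    \<comment> \<open>The cycle leaves \<open>u\<close> by \<open>e\<close>, follows
      \<open>r\<close> and returns by the arc opposite to \<open>f\<close>.\<close>
    let ?c = "e # r @ [(snd f, u)]"
    have rw: "awalk (snd e) r (snd f)" using r by (rule awalkI_apath)
    have uw: "awalk (snd f) [(snd f, u)] u"
      using back_arc by (auto simp: awalk_simps intro: in_arcsD2)
    have rc: "awalk (snd e) (r @ [(snd f, u)]) u"
      by (rule awalk_appendI[OF rw uw])
    have "awalk u ?c u" using rc e unfolding awalk_Cons_iff by blast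
    moreover have "tl (awalk_verts u ?c) = awalk_verts (snd e) r @ [u]"
      using awalk_verts_append[OF rc] by simp
    moreover have "distinct (awalk_verts (snd e) r @ [u])"
      using r ur by (simp add: apath_def)
    ultimately have "cycle ?c" unfolding cycle_def by auto
    \<comment> \<open>Since \<open>r\<close> has at least one arc, \<open>?c\<close> has at least
      three and is not just an edge traversed back and forth.\<close>
    moreover have "r \<noteq> []" using r False by (auto simp: apath_Nil_iff)
    ultimately show ?thesis using no_long_cycle[of ?c] by (cases r) auto
  qed
qed

section \<open>Distances in a tree\<close>

lemma distance_apath:
  assumes "apath u p v"
  shows "distance G u v = length p"
proof -
  \<comment> \<open>By uniqueness every walk \<open>q\<close> with these ends reduces to
    \<open>p\<close>. All arcs of \<open>p\<close> thus occur in \<open>q\<close>, and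
    \<open>p\<close> repeats none of them.\<close>
  have "length p \<le> length q" if q: "awalk u q v" for q
  proof -
    have p: "p = awalk_to_apath q"
      using apath_unique[OF assms apath_awalk_to_apath[OF q]] .
    have "distinct p"
      using assms distinct_verts_imp_distinct unfolding apath_def by blast
    then have "length p = card (set p)" by (simp add: distinct_card)
    also have "\<dots> \<le> card (set q)"
      using awalk_to_apath_subset[OF q] p by (simp add: card_mono)
    also have "\<dots> \<le> length q" by (rule card_length)
    finally show ?thesis .
  qed
  then have "length p \<le> distance G u v"
    unfolding distance_def using awalkI_apath[OF assms] by (intro cINF_greatest) auto
  with distance_le_length_awalk[OF awalkI_apath[OF assms]] show ?thesis by simp
qed

text \<open>With only one path between two vertices, the longest is also the shortest. From here on
  the metric properties of \<open>distance\<close> apply to detour distances.\<close>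

lemma detour_distance_eq_distance:
  assumes "u \<in> pverts G" "v \<in> pverts G"
  shows "detour_distance G u v = distance G u v"
proof -
  obtain p where p: "apath u p v" using apath_exists assms by blast
  then have "{p. apath u p v} = {p}" using apath_unique by auto
  then show ?thesis unfolding detour_distance_def distance_apath[OF p] by simp
qed

lemma distance_triangle:
  assumes "u \<in> pverts G" "v \<in> pverts G" "w \<in> pverts G"
  shows "distance G u w \<le> distance G u v + distance G v w"
proof -
  obtain p q where pq: "apath u p v" "apath v q w" using apath_exists assms by metis
  then have "awalk u (p @ q) w" using awalk_appendI awalkI_apath by blast
  from distance_le_length_awalk[OF this] show ?thesis
    using pq distance_apath by simp
qed

lemma distance_sym:
  assumes "u \<in> pverts G" "v \<in> pverts G"
  shows "distance G u v = distance G v u"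
proof -
  obtain p where p: "apath u p v" using apath_exists assms by blast
  then have "apath v (rev_path p) u" by simp
  moreover have "length (rev_path p) = length p" by (induction p) auto
  ultimately show ?thesis using p distance_apath by metis
qed

lemma distance_eq_0_iff:
  assumes "u \<in> pverts G" "v \<in> pverts G"
  shows "distance G u v = 0 \<longleftrightarrow> u = v"
proof -
  obtain p where p: "apath u p v" using apath_exists assms by blast
  then show ?thesis using distance_apath[OF p] apath_same_ends by (auto simp: apath_Nil_iff)
qed

lemma apath_arc:
  assumes "e \<in> parcs G"
  shows "apath (fst e) [e] (snd e)"
  using assms no_loops by (auto simp: apath_Cons_iff apath_Nil_iff arc_snd_in_verts)

lemma distance_eq_1_arc:
  assumes "u \<in> pverts G" "v \<in> pverts G" "distance G u v = 1"
  shows "(u, v) \<in> parcs G"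
proof -
  obtain p where p: "apath u p v" using apath_exists assms by blast
  then have "length p = 1" using distance_apath assms(3) by simp
  then obtain e where "p = [e]" by (cases p) auto
  with p show ?thesis by (cases e) (auto simp: apath_Cons_iff apath_Nil_iff)
qed

text \<open>Paths leaving \<open>x\<close> by different arcs meet only at \<open>x\<close>: a
  further common vertex would be reached by two different paths. Hence \<open>s\<close> reversed and
  followed by \<open>r\<close> is again a path.\<close>

lemma distance_branch:
  assumes r: "apath x r v" "r \<noteq> []" and s: "apath x s w" "s \<noteq> []" and "hd r \<noteq> hd s"
  shows "distance G w v = distance G w x + distance G x v"
proof -
  have rv: "awalk_verts w (rev_path s) = rev (awalk_verts x s)"
    using awalk_verts_rev_path[OF awalkI_apath[OF s(1)]] .
  have disj: "set (awalk_verts x s) \<inter> set (tl (awalk_verts x r)) = {}"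
  proof (rule ccontr)
    assume "\<not> ?thesis"
    then obtain y where y: "y \<in> set (awalk_verts x s)" "y \<in> set (tl (awalk_verts x r))"
      by blast
    have "awalk_verts x r = x # tl (awalk_verts x r)"
      using r by (cases r) (auto simp: apath_Cons_iff)
    moreover have "distinct (awalk_verts x r)" using r by (simp add: apath_def)
    ultimately have "y \<noteq> x" "y \<in> set (awalk_verts x r)"
      using y(2) by (metis distinct.simps(2), metis list.set_intros(2))
    obtain r1 r2 where r12: "r = r1 @ r2" "awalk x r1 y" "awalk y r2 v"
      using awalk_decomp[OF awalkI_apath[OF r(1)]] \<open>y \<in> set (awalk_verts x r)\<close> by blast
    obtain s1 s2 where s12: "s = s1 @ s2" "awalk x s1 y" "awalk y s2 w"
      using awalk_decomp[OF awalkI_apath[OF s(1)]] y(1) by blast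
    have "apath x r1 y" using r(1) r12 by (auto simp: apath_append_iff)
    moreover have "apath x s1 y" using s(1) s12 by (auto simp: apath_append_iff)
    ultimately have "r1 = s1" by (rule apath_unique)
    moreover have "r1 \<noteq> []" using \<open>apath x r1 y\<close> \<open>y \<noteq> x\<close> by (auto simp: apath_Nil_iff)
    ultimately show False using \<open>hd r \<noteq> hd s\<close> r12 s12 by simp
  qed
  have rs: "apath w (rev_path s) x" using s by simp
  moreover have "last (awalk_verts w (rev_path s)) = x"
    using awalkI_apath[OF rs] by blast
  ultimately have "apath w (rev_path s @ r) v"
    unfolding apath_append_iff using r disj rv by simp
  from distance_apath[OF this] show ?thesis
    using distance_apath[OF rs] distance_apath[OF r(1)] by simp
qed

section \<open>Eccentricity and the center\<close>

lemma distance_le_eccentricity: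
  "v \<in> pverts G \<Longrightarrow> distance G u v \<le> eccentricity G u"
  unfolding eccentricity_def using pair_finite_verts by simp

lemma eccentricity_attained:
  obtains v where "v \<in> pverts G" "distance G u v = eccentricity G u"
proof -
  have "eccentricity G u \<in> distance G u ` pverts G"
    unfolding eccentricity_def using pair_finite_verts verts_nonempty by (intro Max_in) auto
  then show thesis using that by auto
qed

text \<open>The neighbour of one central vertex towards a distant other one would have a smaller
  eccentricity: any vertex branches off at that neighbour from the path to one of the two.\<close>

lemma distance_center_le_1:
  assumes w: "w \<in> center G" and w': "w' \<in> center G"
  shows "distance G w w' \<le> 1"
proof (rule ccontr)
  assume far: "\<not> ?thesis"
  have V: "w \<in> pverts G" "w' \<in> pverts G" using w w' by (auto simp: center_def)
  obtain p where p: "apath w p w'" using apath_exists V by blast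
  then have "length p \<ge> 2" using far distance_apath by simp
  then obtain e p2 where ep: "p = e # p2" "p2 \<noteq> []"
    \<comment> \<open>This case rule separates empty, singleton and longer lists; only the last kind
      has length at least 2.\<close>
    by (cases p rule: remdups_adj.cases) auto
  define x where "x = snd e"
  have e: "e \<in> parcs G" "fst e = w" "apath x p2 w'" "w \<notin> set (awalk_verts x p2)"
    using p unfolding ep x_def by (auto simp: apath_Cons_iff)
  have xw: "apath x [(x, w)] w"
    using apath_arc[of "(x, w)"] arcs_symmetric e x_def by (metis fst_conv prod.collapse snd_conv)
  have x: "x \<in> pverts G" using e(3) unfolding apath_def by auto
  \<comment> \<open>The arcs from \<open>x\<close> towards \<open>w\<close> and towards
    \<open>w'\<close> differ, for otherwise \<open>p\<close> would return to its start
    \<open>w\<close>.\<close>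
  have ne: "hd p2 \<noteq> (x, w)"
  proof
    assume "hd p2 = (x, w)"
    then obtain q where q: "p2 = (x, w) # q" using ep(2) by (cases p2) auto
    then have "apath w q w'" using e(3) by (simp add: apath_Cons_iff)
    then have "w \<in> set (awalk_verts w q)" using hd_in_awalk_verts awalkI_apath by blast
    then show False using e(4) q by simp
  qed
  have ecc: "eccentricity G w \<le> eccentricity G x" "eccentricity G w' \<le> eccentricity G x"
    using w w' x by (auto simp: center_def)
  obtain v where v: "v \<in> pverts G" "distance G x v = eccentricity G x"
    by (rule eccentricity_attained)
  have wx: "distance G w x = 1"
    using distance_apath[OF xw] distance_sym V x by simp
  have w'x: "distance G w' x > 0"
    using distance_apath[OF e(3)] distance_sym V x ep by simp
  obtain r where r: "apath x r v" using apath_exists x v by blast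
  \<comment> \<open>By \<open>ne\<close>, the first arc of \<open>r\<close> differs from one of the
    two arcs, so \<open>v\<close> is farther from \<open>w\<close> or from \<open>w'\<close> than
    the eccentricity of \<open>x\<close>. An empty \<open>r\<close> would give \<open>x\<close>,
    hence also the central \<open>w\<close>, eccentricity 0, although they are at distance
    1.\<close>
  consider "r = []" | "r \<noteq> []" "hd r \<noteq> (x, w)" | "r \<noteq> []" "hd r \<noteq> hd p2"
    using ne by metis
  then show False
  proof cases
    case 1
    then have "distance G x v = 0" using distance_apath[OF r] by simp
    then show False using wx v ecc distance_le_eccentricity[OF x, of w] by simp
  next
    case 2
    then have "distance G w v = distance G w x + distance G x v"
      using distance_branch[OF r _ xw] by simp
    then show False using wx v ecc distance_le_eccentricity[OF v(1), of w] by simp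
  next
    case 3
    then have "distance G w' v = distance G w' x + distance G x v"
      using distance_branch[OF r _ e(3) ep(2)] by simp
    then show False using w'x v ecc distance_le_eccentricity[OF v(1), of w'] by simp
  qed
qed

lemma center_nonempty: "center G \<noteq> {}"
proof -
  obtain u where "is_arg_min (eccentricity G) (\<lambda>u. u \<in> pverts G) u"
    using ex_is_arg_min_if_finite[OF pair_finite_verts verts_nonempty] by blast
  then show ?thesis unfolding center_def is_arg_min_linorder by auto
qed

lemma finite_center: "finite (center G)"
  unfolding center_def using pair_finite_verts by simp

text \<open>Three central vertices would be pairwise adjacent, and a triangle offers two paths
  between two of its corners.\<close>

lemma card_center_le_2: "card (center G) \<le> 2"
proof (rule ccontr)
  assume "\<not> ?thesis"
  then obtain S where "S \<subseteq> center G" "card S = 3"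
    by (metis obtain_subset_with_card_n not_less_eq_eq numeral_2_eq_2 numeral_3_eq_3)
  then obtain a b c where abc: "a \<in> center G" "b \<in> center G" "c \<in> center G"
      "a \<noteq> b" "b \<noteq> c" "a \<noteq> c"
    by (auto simp: card_3_iff)
  have arc: "(u, v) \<in> parcs G" if "u \<in> center G" "v \<in> center G" "u \<noteq> v" for u v
  proof -
    have V: "u \<in> pverts G" "v \<in> pverts G" using that by (auto simp: center_def)
    then have "distance G u v = 1"
      using distance_center_le_1[OF that(1,2)] distance_eq_0_iff[OF V] that(3) by linarith
    then show ?thesis using distance_eq_1_arc V by simp
  qed
  have "c \<in> pverts G" using abc by (simp add: center_def)
  then have "apath a [(a, b), (b, c)] c"
    using arc abc by (simp add: apath_Cons_iff apath_Nil_iff)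
  moreover have "apath a [(a, c)] c"
    using apath_arc[of "(a, c)"] arc abc by simp
  ultimately show False using apath_unique by blast
qed

lemma card_center_cases: "card (center G) = 1 \<or> card (center G) = 2"
proof -
  have "card (center G) \<noteq> 0" using center_nonempty finite_center by simp
  then show ?thesis using card_center_le_2 by linarith
qed

text \<open>Treats both sizes of the center at once: \<open>eps G\<close> bounds the detour from one
  central vertex to another.\<close>

lemma distance_center_le_eps:
  assumes "w \<in> center G" "w' \<in> center G"
  shows "int (distance G w w') \<le> eps G"
proof (cases "card (center G) = 1")
  case True
  then have "w = w'" using assms by (auto simp: card_1_singleton_iff)
  moreover have "w \<in> pverts G" using assms by (simp add: center_def)
  ultimately show ?thesis using True distance_eq_0_iff by (simp add: eps_def)
next
  case False
  then show ?thesis using card_center_cases distance_center_le_1[OF assms] by (auto simp: eps_def)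
qed

section \<open>Detour levels\<close>

lemma detour_level_attained:
  assumes "u \<in> pverts G"
  obtains w where "w \<in> center G" "detour_level G u = distance G u w"
proof -
  have "detour_level G u \<in> detour_distance G u ` center G"
    unfolding detour_level_def using center_nonempty finite_center by (intro Min_in) auto
  then obtain w where "w \<in> center G" "detour_level G u = detour_distance G u w" by blast
  with that show thesis
    using detour_distance_eq_distance[OF assms] by (auto simp: center_def)
qed

text \<open>Triangle inequality along \<open>u\<close>, \<open>w\<close>, \<open>w'\<close>,
  \<open>v\<close>, where \<open>w\<close> and \<open>w'\<close> are central vertices nearest to
  \<open>u\<close> and \<open>v\<close>.\<close>

lemma detour_distance_le_levels:
  assumes "u \<in> pverts G" "v \<in> pverts G"
  shows "int (detour_distance G u v) \<le> int (detour_level G u) + int (detour_level G v) + eps G"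
proof -
  obtain w where w: "w \<in> center G" "detour_level G u = distance G u w"
    using detour_level_attained assms by blast
  obtain w' where w': "w' \<in> center G" "detour_level G v = distance G v w'"
    using detour_level_attained assms by blast
  have V: "w \<in> pverts G" "w' \<in> pverts G" using w w' by (auto simp: center_def)
  have "distance G u v \<le> distance G u w + distance G w v"
    using distance_triangle assms V by blast
  also have "distance G w v \<le> distance G w w' + distance G w' v"
    using distance_triangle assms V by blast
  finally show ?thesis
    using distance_center_le_eps[OF w(1) w'(1)] distance_sym[OF assms(2) V(2)] w w'
      detour_distance_eq_distance[OF assms] by simp
qed

text \<open>A unique central vertex is the only vertex of level 0, so one of the two levels is
  positive. With two central vertices the left side is 0.\<close>

lemma eps'_le_levels:
  assumes "u \<in> pverts G" "v \<in> pverts G" "u \<noteq> v"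
  shows "eps' G \<le> int (detour_level G u) + int (detour_level G v)"
proof (cases "card (center G) = 1")
  case True
  then obtain w where C: "center G = {w}" by (auto simp: card_1_singleton_iff)
  then have w: "w \<in> pverts G" by (auto simp: center_def)
  have "detour_level G u = distance G u w" "detour_level G v = distance G v w"
    using C assms w by (simp_all add: detour_level_def detour_distance_eq_distance)
  then have "detour_level G u \<noteq> 0 \<or> detour_level G v \<noteq> 0"
    using assms w by (auto simp: distance_eq_0_iff)
  then show ?thesis using True by (auto simp: eps'_def eps_def)
next
  case False
  then show ?thesis using card_center_cases by (auto simp: eps'_def eps_def)
qed

section \<open>Lower bound for a single colouring\<close>

lemma coloring_value_lower_bound:
  assumes c: "hamiltonian_coloring G c" and n: "order G = n" "n \<ge> 2"
  shows "int (coloring_value G c) \<ge>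
    (int n - 1) * (int n - 1 - eps G) + eps' G - 2 * int (total_detour_level G)"
proof -
  obtain xs where xs: "set xs = pverts G" "distinct xs"
    using finite_distinct_list[OF pair_finite_verts] by blast
  define ys where "ys = sort_key c xs"
  have ys: "set ys = pverts G" "distinct ys" "sorted (map c ys)"
    using xs unfolding ys_def by auto
  have len: "length ys = n" using ys n distinct_card by (fastforce simp: order_def)
  define m where "m = n - 1"
  have m: "n = Suc m" "m \<ge> 1" using n unfolding m_def by auto
  define L where "L i = int (detour_level G (ys ! i))" for i
  have V: "ys ! i \<in> pverts G" if "i \<le> m" for i
    using that ys len m by (metis less_Suc_eq_le nth_mem)
  have step: "int m - eps G - (L i + L (Suc i)) \<le> int (c (ys ! Suc i)) - int (c (ys ! i))"
    if "i < m" for i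
  proof -
    have v: "ys ! i \<in> pverts G" "ys ! Suc i \<in> pverts G" using that V by auto
    have "ys ! i \<noteq> ys ! Suc i" using that ys len m by (simp add: nth_eq_iff_index_eq)
    then have "int m \<le> int (detour_distance G (ys ! i) (ys ! Suc i))
        + \<bar>int (c (ys ! i)) - int (c (ys ! Suc i))\<bar>"
      using c v n m unfolding hamiltonian_coloring_def by fastforce
    moreover have "c (ys ! i) \<le> c (ys ! Suc i)"
      using sorted_nth_mono[OF ys(3), of i "Suc i"] that len m by simp
    ultimately show ?thesis
      using detour_distance_le_levels[OF v] unfolding L_def by simp
  qed
  have total: "int (total_detour_level G) = (\<Sum>i<Suc m. L i)"
  proof -
    have "total_detour_level G = sum_list (map (detour_level G) ys)"
      unfolding total_detour_level_def using ys sum_list_distinct_conv_sum_set by metis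
    then show ?thesis
      using len m by (simp add: sum_list_sum_nth atLeast0LessThan L_def)
  qed
  \<comment> \<open>Of the \<open>Suc m\<close> levels, this sum omits the last, and the shifted sum
    after it omits the first.\<close>
  have first: "(\<Sum>i<m. L i) = int (total_detour_level G) - L m"
    unfolding total by simp
  have last: "(\<Sum>i<m. L (Suc i)) = int (total_detour_level G) - L 0"
    unfolding total by (simp only: sum.lessThan_Suc_shift)
  have "int m * (int m - eps G) - 2 * int (total_detour_level G) + L 0 + L m
      = (\<Sum>i<m. int m - eps G - (L i + L (Suc i)))"
    by (simp add: sum_subtractf sum.distrib first last)
  also have "\<dots> \<le> (\<Sum>i<m. int (c (ys ! Suc i)) - int (c (ys ! i)))"
    using step by (intro sum_mono) simp
  also have "\<dots> = int (c (ys ! m)) - int (c (ys ! 0))"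
    by (rule sum_lessThan_telescope)
  \<comment> \<open>The smallest colour is subtracted here; being nonnegative, it may be
    dropped.\<close>
  also have "\<dots> \<le> int (coloring_value G c)"
  proof -
    have "c (ys ! m) \<le> coloring_value G c"
      unfolding coloring_value_def using pair_finite_verts V by (intro Max_ge) auto
    then show ?thesis by simp
  qed
  finally have "int m * (int m - eps G) - 2 * int (total_detour_level G) + L 0 + L m
      \<le> int (coloring_value G c)" .
  \<comment> \<open>As \<open>m\<close> is at least 1, the first and last vertices of
    \<open>ys\<close> are distinct.\<close>
  moreover have "eps' G \<le> L 0 + L m"
    unfolding L_def using V ys len m
    by (intro eps'_le_levels) (auto simp: nth_eq_iff_index_eq)
  ultimately show ?thesis using m by simp
qed

end

section \<open>Existence of an optimal colouring\<close>

lemma ex_hamiltonian_coloring: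
  assumes "finite (pverts G)"
  shows "\<exists>c. hamiltonian_coloring G c"
proof -
  obtain f :: "'a \<Rightarrow> nat" where f: "inj_on f (pverts G)"
    using finite_imp_inj_to_nat_seg[OF assms] by blast
  \<comment> \<open>Scaling the injective numbering \<open>f\<close> by the order separates any two
    colours by at least \<open>order G\<close>, whatever the detour distance.\<close>
  have "hamiltonian_coloring G (\<lambda>u. order G * f u)"
    unfolding hamiltonian_coloring_def
  proof (intro ballI impI)
    fix u v assume "u \<in> pverts G" "v \<in> pverts G" "u \<noteq> v"
    then have "\<bar>int (f u) - int (f v)\<bar> \<ge> 1" using f unfolding inj_on_def by fastforce
    then have "int (order G) * 1 \<le> int (order G) * \<bar>int (f u) - int (f v)\<bar>"
      by (intro mult_left_mono) auto
    also have "\<dots> = \<bar>int (order G * f u) - int (order G * f v)\<bar>"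
      by (simp add: abs_mult flip: right_diff_distrib)
    finally show "int (order G) - 1 \<le> int (detour_distance G u v)
        + \<bar>int (order G * f u) - int (order G * f v)\<bar>" by simp
  qed
  then show ?thesis by blast
qed

text \<open>A nonempty set of naturals contains its infimum. Bounding the value of every hamiltonian
  colouring therefore bounds the chromatic number.\<close>

lemma hamiltonian_chromatic_number_attained:
  assumes "finite (pverts G)"
  obtains c where "hamiltonian_coloring G c"
    "hamiltonian_chromatic_number G = coloring_value G c"
proof -
  have "hamiltonian_chromatic_number G \<in> coloring_value G ` {c. hamiltonian_coloring G c}"
    unfolding hamiltonian_chromatic_number_def
    using ex_hamiltonian_coloring[OF assms] by (intro Inf_nat_def1) blast
  then show thesis using that by blast
qed

theorem theorem4:
  fixes T :: "'a pair_pre_digraph" and n :: nat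
  assumes "undirected_tree T"
    and "order T = n"
    and "n \<ge> 4"
    and "max_degree T \<ge> 3"
  shows "int (hamiltonian_chromatic_number T) \<ge>
    (int n - 1) * (int n - 1 - eps T) + eps' T - 2 * int (total_detour_level T)"
proof -
  interpret tree_graph T
    using assms(1) by (simp add: tree_graph_def tree_graph_axioms_def undirected_tree_def)
  obtain c where "hamiltonian_coloring T c" "hamiltonian_chromatic_number T = coloring_value T c"
    using hamiltonian_chromatic_number_attained[OF pair_finite_verts] .
  then show ?thesis using coloring_value_lower_bound assms by simp
qed

end
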